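(* For $q>1$ and $|u|<1/q$, $$\sum_{n \geq 0} u^n q^{n^2} \left[ \sum_{r=0}^{2n} \frac{1}{|O^+(r,q)||O^+(2n-r,q)|} + \sum_{r=1}^{2n-1} \frac{1}{|O^-(r,q)||O^-(2n-r,q)|} \right]$$ is equal to $$\frac{1}{2 (1-uq)} \frac{\prod_{i \geq 1} (1+u/q^{2(i-1)})^2}{\prod_{i \geq 1} (1-u^2/q^{2(i-1)})} + \frac{1}{2} \frac{\prod_{i \geq 1} (1+u/q^{2i-1})^2}{\prod_{i \geq 1} (1-u^2/q^{2(i-1)})}.$$
   Context: Here $q$ is a real number, $u$ is a complex number, and $|O^{\pm}(r,q)|$ denote the following expressions (which for odd prime powers $q$ are orders of finite orthogonal groups): for $m\ge 0$, $|O^{+}(2m+1,q)|=|O^{-}(2m+1,q)|=2q^{m^2}\prod_{i=1}^m(q^{2i}-1)$ (so $|O^{\pm}(1,q)|=2$); for $m\ge 1$, $|O^{\pm}(2m,q)|=\frac{2q^{m^2-m}}{q^m\pm 1}\prod_{i=1}^m (q^{2i}-1)$; and by convention $|O^+(0,q)|=1$ and $1/|O^-(0,q)|=0$. Sums whose upper limit is less than their lower limit are empty (equal to $0$). *)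

theory Defs
  imports "HOL-Analysis.Analysis"
begin

definition O_plus_order :: "nat \<Rightarrow> real \<Rightarrow> real" where
  "O_plus_order r q =
    (let m = r div 2 in
     if r = 0 then 1
     else if odd r then 2 * q ^ (m ^ 2) * (\<Prod>i=1..m. q ^ (2 * i) - 1)
     else 2 * q ^ (m ^ 2 - m) / (q ^ m + 1) * (\<Prod>i=1..m. q ^ (2 * i) - 1))"

(* The value 0 at r = 0 encodes the convention 1 / |O^-(0,q)| = 0, since 1 / 0 = 0 in HOL. *)
definition O_minus_order :: "nat \<Rightarrow> real \<Rightarrow> real" where
  "O_minus_order r q =
    (let m = r div 2 in
     if r = 0 then 0
     else if odd r then 2 * q ^ (m ^ 2) * (\<Prod>i=1..m. q ^ (2 * i) - 1)
     else 2 * q ^ (m ^ 2 - m) / (q ^ m - 1) * (\<Prod>i=1..m. q ^ (2 * i) - 1))"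

end

theory Submission
  imports Defs
begin

text \<open>
  Put \<open>t = 1 / q\<close> and \<open>x = t\<^sup>2\<close>. Up to elementary factors, the orders of the groups
  \<open>O\<^sup>\<plusminus>(2a)\<close> and \<open>O\<^sup>\<plusminus>(2a + 1)\<close> are the q-Pochhammer symbol \<open>(x; x)\<^sub>a\<close>, and the series in the theorem
  becomes \<open>((1 + u q) F(u q) + F(u)) / 2\<close>, where
  \<open>F(u) = (\<Sum>a,b. u\<^bsup>a+b\<^esup> t\<^bsup>(a-b)\<^sup>2\<^esup> / ((x; x)\<^sub>a (x; x)\<^sub>b))\<close>.
  For fixed \<open>b\<close>, the sum over \<open>a\<close> is Euler's series. It evaluates to a product in which \<open>b\<close> factors
  are split off, and the sum over \<open>b\<close> that remains is an instance of the q-binomial theorem. Hence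
  \<open>F(u) = (-u t; x)\<^sub>\<infinity>\<^sup>2 / (u\<^sup>2; x)\<^sub>\<infinity>\<close>.
\<close>

section \<open>q-Pochhammer symbols, finite and infinite\<close>

definition qpoch :: "'a::comm_ring_1 \<Rightarrow> 'a \<Rightarrow> nat \<Rightarrow> 'a" where
  "qpoch a x n = (\<Prod>i<n. 1 - a * x ^ i)"

definition qpoch_inf :: "'a::real_normed_field \<Rightarrow> 'a \<Rightarrow> 'a" where
  "qpoch_inf a x = (\<Prod>i. 1 - a * x ^ i)"

lemma qpoch_0 [simp]: "qpoch a x 0 = 1"
  by (simp add: qpoch_def)

lemma qpoch_Suc: "qpoch a x (Suc n) = qpoch a x n * (1 - a * x ^ n)"
  by (simp add: qpoch_def)

lemma of_real_qpoch:
  "of_real (qpoch a x n) = (qpoch (of_real a) (of_real x) n :: 'a::{real_algebra_1,comm_ring_1})"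
  by (simp add: qpoch_def)

lemma one_minus_mult_power_nonzero:
  fixes a x :: "'a::real_normed_field"
  assumes "norm a < 1" "norm x < 1"
  shows "1 - a * x ^ n \<noteq> 0"
proof
  assume "1 - a * x ^ n = 0"
  then have "norm (a * x ^ n) = 1" by simp
  moreover have "norm (a * x ^ n) \<le> norm a"
    using assms by (simp add: norm_mult norm_power mult_left_le power_le_one)
  ultimately show False using assms by simp
qed

lemma convergent_prod_qpoch_inf:
  fixes a x :: "'a::{real_normed_field,banach}"
  assumes "norm x < 1"
  shows "convergent_prod (\<lambda>i. 1 - a * x ^ i)"
proof (rule abs_convergent_prod_imp_convergent_prod)
  have "summable (\<lambda>i. norm a * norm x ^ i)"
    using assms by (intro summable_mult summable_geometric) simp
  then show "abs_convergent_prod (\<lambda>i. 1 - a * x ^ i)"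
    by (simp add: abs_convergent_prod_conv_summable norm_mult norm_power)
qed

lemma qpoch_LIMSEQ:
  fixes a x :: "'a::{real_normed_field,banach}"
  assumes "norm x < 1"
  shows "qpoch a x \<longlonglongrightarrow> qpoch_inf a x"
  using convergent_prod_LIMSEQ[OF convergent_prod_qpoch_inf[OF assms, of a]]
  unfolding qpoch_def[abs_def] qpoch_inf_def by (subst LIMSEQ_lessThan_iff_atMost)

lemma qpoch_inf_nonzero:
  fixes a x :: "'a::{real_normed_field,banach}"
  assumes "norm a < 1" "norm x < 1"
  shows "qpoch_inf a x \<noteq> 0"
  unfolding qpoch_inf_def
  using assms by (intro prodinf_nonzero convergent_prod_qpoch_inf one_minus_mult_power_nonzero)

text \<open>A finite product can also be peeled at its first factor, and the identity passes to the
  limit. This moves the parameter by one power of \<open>x\<close>; it splits off factors for the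
  inner sums and later relates the denominators at \<open>u q\<close> and at
  \<open>u\<close>.\<close>

lemma qpoch_inf_rec:
  fixes a x :: "'a::{real_normed_field,banach}"
  assumes "norm x < 1"
  shows "qpoch_inf a x = (1 - a) * qpoch_inf (a * x) x"
proof -
  have "qpoch a x (Suc n) = (1 - a) * qpoch (a * x) x n" for n
    unfolding qpoch_def by (subst prod.lessThan_Suc_shift) (simp add: mult.assoc)
  then have "(\<lambda>n. qpoch a x (Suc n)) \<longlonglongrightarrow> (1 - a) * qpoch_inf (a * x) x"
    using tendsto_mult_left[OF qpoch_LIMSEQ[OF assms, of "a * x"]] by simp
  moreover have "(\<lambda>n. qpoch a x (Suc n)) \<longlonglongrightarrow> qpoch_inf a x"
    using qpoch_LIMSEQ[OF assms] by (rule LIMSEQ_Suc)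
  ultimately show ?thesis by (rule LIMSEQ_unique[rotated])
qed

section \<open>The q-binomial theorem\<close>

text \<open>
  With \<open>a = c z\<close> this is the usual \<open>(c; x)\<^sub>n z\<^sup>n / (x; x)\<^sub>n\<close>. The homogeneous form also covers
  Euler's series (\<open>z = 0\<close>).
\<close>

definition qbinom_term :: "'a::field \<Rightarrow> 'a \<Rightarrow> 'a \<Rightarrow> nat \<Rightarrow> 'a" where
  "qbinom_term x z a n = (\<Prod>j<n. z - a * x ^ j) / qpoch x x n"

lemma qbinom_term_Suc:
  "qbinom_term x z a (Suc n) = qbinom_term x z a n * ((z - a * x ^ n) / (1 - x ^ Suc n))"
  by (simp add: qbinom_term_def qpoch_Suc)

text \<open>Homogeneity. With \<open>c = x ^ N\<close>, shrinking both parameters amounts to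
  evaluating a power series with fixed coefficients at \<open>x ^ N\<close>.\<close>

lemma qbinom_term_scale: "qbinom_term x (c * z) (c * a) n = c ^ n * qbinom_term x z a n"
proof -
  have "(\<Prod>j<n. c * z - c * a * x ^ j) = (\<Prod>j<n. c * (z - a * x ^ j))"
    by (intro prod.cong) (simp_all add: algebra_simps)
  also have "\<dots> = c ^ n * (\<Prod>j<n. z - a * x ^ j)"
    by (simp add: prod.distrib)
  finally show ?thesis by (simp add: qbinom_term_def)
qed

text \<open>The ratio of consecutive terms tends to \<open>z\<close>, so the ratio test applies with
  any \<open>c\<close> strictly between \<open>norm z\<close> and 1.\<close>

lemma summable_norm_qbinom_term:
  fixes x z a :: "'a::{real_normed_field,banach}"
  assumes x: "norm x < 1" and z: "norm z < 1"
  shows "summable (\<lambda>n. norm (qbinom_term x z a n))"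
proof -
  have px: "(\<lambda>n. x ^ n) \<longlonglongrightarrow> 0"
    using x by (rule LIMSEQ_power_zero)
  have "(\<lambda>n. norm ((z - a * x ^ n) / (1 - x ^ Suc n))) \<longlonglongrightarrow> norm ((z - a * 0) / (1 - 0))"
    by (intro tendsto_intros px LIMSEQ_Suc[OF px]) simp
  then have lim: "(\<lambda>n. norm ((z - a * x ^ n) / (1 - x ^ Suc n))) \<longlonglongrightarrow> norm z" by simp
  obtain c where c: "norm z < c" "c < 1" using z dense by blast
  from order_tendstoD(2)[OF lim c(1)] obtain N
    where N: "\<And>n. n \<ge> N \<Longrightarrow> norm ((z - a * x ^ n) / (1 - x ^ Suc n)) < c"
    by (auto simp: eventually_sequentially)
  show ?thesis
  proof (rule summable_ratio_test[OF c(2)])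
    fix n assume "n \<ge> N"
    then have "norm (qbinom_term x z a n) * norm ((z - a * x ^ n) / (1 - x ^ Suc n))
        \<le> norm (qbinom_term x z a n) * c"
      using N by (intro mult_left_mono) (auto intro: less_imp_le)
    then show "norm (norm (qbinom_term x z a (Suc n))) \<le> c * norm (norm (qbinom_term x z a n))"
      unfolding qbinom_term_Suc norm_mult by (simp add: mult.commute)
  qed
qed

text \<open>The recurrence \<open>(1 - x ^ Suc n) T (Suc n) = (z - a x ^ n) T n\<close>, summed over
  \<open>n\<close>, is a linear relation between the series \<open>S\<close> and its version
  \<open>S'\<close> weighted by \<open>x ^ n\<close>. By homogeneity \<open>S'\<close> is the same
  series at \<open>x z\<close> and \<open>x a\<close>.\<close>

lemma qbinomial_functional_equation:
  fixes x z a :: "'a::{real_normed_field,banach}"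
  assumes x: "norm x < 1" and z: "norm z < 1"
  shows "(1 - z) * (\<Sum>n. qbinom_term x z a n) = (1 - a) * (\<Sum>n. qbinom_term x (x * z) (x * a) n)"
proof -
  define T where "T = qbinom_term x z a"
  define S where "S = (\<Sum>n. T n)"
  define S' where "S' = (\<Sum>n. x ^ n * T n)"
  have sm: "summable T"
    unfolding T_def by (rule summable_norm_cancel[OF summable_norm_qbinom_term[OF x z]])
  have xz: "norm (x * z) < 1"
    using x z mult_strict_mono'[of "norm x" 1 "norm z" 1] by (simp add: norm_mult)
  have sm': "summable (\<lambda>n. x ^ n * T n)"
    using summable_norm_cancel[OF summable_norm_qbinom_term[OF x xz, of "x * a"]]
    by (simp add: qbinom_term_scale T_def)
  have step: "T (Suc n) - x ^ Suc n * T (Suc n) = z * T n - a * (x ^ n * T n)" for n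
  proof -
    have "1 - x ^ Suc n \<noteq> 0"
      using one_minus_mult_power_nonzero[OF x x, of n] by simp
    then show ?thesis
      unfolding T_def qbinom_term_Suc by (simp add: divide_simps) (simp add: algebra_simps)
  qed
  have "(\<lambda>n. T n - x ^ n * T n) sums (S - S')"
    unfolding S_def S'_def by (intro sums_diff summable_sums sm sm')
  \<comment> \<open>The shift of index costs nothing: the term at 0 is
    \<open>T 0 - T 0\<close>.\<close>
  then have "(\<lambda>n. T (Suc n) - x ^ Suc n * T (Suc n)) sums (S - S')"
    by (subst sums_Suc_iff) simp
  moreover have "(\<lambda>n. z * T n - a * (x ^ n * T n)) sums (z * S - a * S')"
    unfolding S_def S'_def by (intro sums_diff sums_mult summable_sums sm sm')
  ultimately have "S - S' = z * S - a * S'"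
    unfolding step by (rule sums_unique2)
  moreover have "S' = (\<Sum>n. qbinom_term x (x * z) (x * a) n)"
    by (simp add: S'_def T_def qbinom_term_scale)
  ultimately show ?thesis
    by (simp add: S_def T_def algebra_simps)
qed

text \<open>Iterating the functional equation \<open>N\<close> times produces finite products on
  both sides and leaves the series \<open>S N\<close> at parameters \<open>x ^ N * z\<close> and
  \<open>x ^ N * a\<close>. As \<open>N\<close> grows the products converge to the infinite ones and
  \<open>S N\<close> tends to its constant term 1.\<close>

theorem qbinomial_theorem:
  fixes x z a :: "'a::{real_normed_field,banach}"
  assumes x: "norm x < 1" and z: "norm z < 1"
  shows "qbinom_term x z a sums (qpoch_inf a x / qpoch_inf z x)"
proof -
  define S where "S N = (\<Sum>n. qbinom_term x (x ^ N * z) (x ^ N * a) n)" for N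
  have xz: "norm (x ^ N * z) < 1" for N
  proof -
    have "norm (x ^ N * z) \<le> norm z"
      using x by (simp add: norm_mult norm_power mult_left_le_one_le power_le_one)
    then show ?thesis using z by simp
  qed
  have fin: "qpoch z x N * S 0 = qpoch a x N * S N" for N
  proof (induction N)
    case (Suc N)
    have step: "(1 - z * x ^ N) * S N = (1 - a * x ^ N) * S (Suc N)"
      using qbinomial_functional_equation[OF x xz, of N "x ^ N * a"]
      by (simp add: S_def mult_ac)
    have "qpoch z x (Suc N) * S 0 = (1 - z * x ^ N) * (qpoch z x N * S 0)"
      by (simp only: qpoch_Suc mult_ac)
    also have "\<dots> = qpoch a x N * ((1 - z * x ^ N) * S N)"
      unfolding Suc by (rule mult.left_commute)
    also have "\<dots> = qpoch a x (Suc N) * S (Suc N)"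
      by (simp only: step qpoch_Suc mult.assoc)
    finally show ?case .
  qed simp
  have "S \<longlonglongrightarrow> 1"
  proof -
    \<comment> \<open>\<open>S N\<close> is the value at \<open>x ^ N\<close> of one power series
      \<open>g\<close>. It converges at 1, hence is continuous at 0.\<close>
    define g where "g y = (\<Sum>n. qbinom_term x z a n * y ^ n)" for y
    have "summable (\<lambda>n. qbinom_term x z a n * 1 ^ n)"
      using summable_norm_cancel[OF summable_norm_qbinom_term[OF x z]] by simp
    then have "isCont g 0"
      unfolding g_def by (rule isCont_powser) simp
    then have "(\<lambda>N. g (x ^ N)) \<longlonglongrightarrow> g 0"
      by (rule isCont_tendsto_compose) (rule LIMSEQ_power_zero[OF x])
    moreover have "g 0 = 1"
      unfolding g_def powser_zero by (simp add: qbinom_term_def)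
    moreover have "g (x ^ N) = S N" for N
      unfolding g_def S_def qbinom_term_scale by (simp add: mult.commute)
    ultimately show ?thesis by simp
  qed
  then have "(\<lambda>N. qpoch a x N * S N) \<longlonglongrightarrow> qpoch_inf a x * 1"
    by (intro tendsto_mult qpoch_LIMSEQ x)
  moreover have "(\<lambda>N. qpoch z x N * S 0) \<longlonglongrightarrow> qpoch_inf z x * S 0"
    by (intro tendsto_mult qpoch_LIMSEQ x tendsto_const)
  ultimately have "qpoch_inf z x * S 0 = qpoch_inf a x"
    unfolding fin mult_1_right by (rule LIMSEQ_unique[rotated])
  then have "S 0 = qpoch_inf a x / qpoch_inf z x"
    using qpoch_inf_nonzero[OF z x] by (simp add: field_simps)
  moreover have "qbinom_term x z a sums S 0"
    using summable_sums[OF summable_norm_cancel[OF summable_norm_qbinom_term[OF x z]], of a]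
    by (simp add: S_def)
  ultimately show ?thesis by simp
qed

section \<open>Euler's series and the inner sums of the double series\<close>

text \<open>The exponents \<open>2 j + 1\<close> for \<open>j < n\<close> add up to the square of
  \<open>n\<close>.\<close>

lemma qbinom_term_euler:
  fixes t w :: "'a::field"
  shows "qbinom_term (t ^ 2) 0 (- (w * t)) n = w ^ n * t ^ n\<^sup>2 / qpoch (t ^ 2) (t ^ 2) n"
proof -
  have "(\<Prod>j<n. w * t * (t ^ 2) ^ j) = w ^ n * t ^ n\<^sup>2"
  proof (induction n)
    case (Suc n)
    have "(Suc n)\<^sup>2 = n\<^sup>2 + (2 * n + 1)" by (simp add: power2_eq_square)
    then have "t ^ (Suc n)\<^sup>2 = t ^ n\<^sup>2 * (t * (t ^ 2) ^ n)"
      by (simp only: power_add power_mult) simp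
    with Suc show ?case by (simp add: mult_ac)
  qed simp
  then show ?thesis by (simp add: qbinom_term_def)
qed

text \<open>Dividing \<open>u\<close> by \<open>t ^ (2 * b)\<close> puts \<open>b\<close> extra
  factors in front of the product. The power of \<open>t\<close> on the left is the product of the
  \<open>t ^ (2 * j + 1)\<close> over \<open>j < b\<close>, and each of these clears the denominator
  of one extra factor.\<close>

lemma qpoch_inf_split_off:
  fixes t u :: "'a::{real_normed_field,banach}"
  assumes t: "t \<noteq> 0" "norm t < 1"
  shows "t ^ b\<^sup>2 * qpoch_inf (- (u / t ^ (2 * b) * t)) (t ^ 2)
    = (\<Prod>j<b. u + t ^ (2 * j + 1)) * qpoch_inf (- (u * t)) (t ^ 2)"
proof (induction b)
  case (Suc b)
  have t2: "norm (t ^ 2) < 1" using t by (simp add: norm_power power_less_one_iff)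
  have "- (u / t ^ (2 * Suc b) * t) * t ^ 2 = - (u / t ^ (2 * b) * t)"
    using t by (simp add: field_simps power2_eq_square)
  then have rec: "qpoch_inf (- (u / t ^ (2 * Suc b) * t)) (t ^ 2)
      = (1 + u / t ^ (2 * Suc b) * t) * qpoch_inf (- (u / t ^ (2 * b) * t)) (t ^ 2)"
    using qpoch_inf_rec[OF t2, of "- (u / t ^ (2 * Suc b) * t)"] by simp
  have sq: "t ^ (Suc b)\<^sup>2 = t ^ b\<^sup>2 * t ^ (2 * b + 1)"
    by (simp add: power2_eq_square mult_2 flip: power_add) (simp add: add_ac)
  have factor: "t ^ (2 * b + 1) * (1 + u / t ^ (2 * Suc b) * t) = u + t ^ (2 * b + 1)"
    using t by (simp add: field_simps)
  have "t ^ (Suc b)\<^sup>2 * qpoch_inf (- (u / t ^ (2 * Suc b) * t)) (t ^ 2)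
      = (t ^ (2 * b + 1) * (1 + u / t ^ (2 * Suc b) * t))
        * (t ^ b\<^sup>2 * qpoch_inf (- (u / t ^ (2 * b) * t)) (t ^ 2))"
    unfolding rec sq by (simp only: mult_ac)
  also have "\<dots> = (\<Prod>j<Suc b. u + t ^ (2 * j + 1)) * qpoch_inf (- (u * t)) (t ^ 2)"
    unfolding factor Suc by (simp add: mult_ac)
  finally show ?case .
qed simp

text \<open>
  The exponent is \<open>(a - b)\<^sup>2\<close>, written as \<open>a\<^sup>2 + b\<^sup>2 - 2 a b\<close> because subtraction of naturals truncates.
\<close>

definition hermite_term :: "'a::field \<Rightarrow> nat \<Rightarrow> nat \<Rightarrow> 'a" where
  "hermite_term t a b =
    t ^ a\<^sup>2 * t ^ b\<^sup>2 / t ^ (2 * a * b) / (qpoch (t ^ 2) (t ^ 2) a * qpoch (t ^ 2) (t ^ 2) b)"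

text \<open>The mixed factor \<open>1 / t ^ (2 * a * b)\<close> is absorbed by replacing
  \<open>u\<close> with \<open>u / t ^ (2 * b)\<close>, which leaves Euler's series in
  \<open>a\<close>. After the split the remaining \<open>u ^ b\<close> is spread over the
  \<open>b\<close> factors, and \<open>u * (u + t ^ (2 * j + 1))\<close> is the factor of a
  q-binomial term with parameters \<open>u ^ 2\<close> and \<open>- (u * t)\<close>.\<close>

lemma hermite_term_sums_left:
  fixes t u :: "'a::{real_normed_field,banach}"
  assumes t: "t \<noteq> 0" "norm t < 1"
  shows "(\<lambda>a. u ^ (a + b) * hermite_term t a b)
    sums (qbinom_term (t ^ 2) (u ^ 2) (- (u * t)) b * qpoch_inf (- (u * t)) (t ^ 2))"
proof -
  let ?Q = "qpoch (t ^ 2) (t ^ 2)"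
  have t2: "norm (t ^ 2) < 1" using t by (simp add: norm_power power_less_one_iff)
  have inf0: "qpoch_inf (0::'a) (t ^ 2) = 1"
    by (simp add: qpoch_inf_def)
  have "qbinom_term (t ^ 2) 0 (- (u / t ^ (2 * b) * t)) sums qpoch_inf (- (u / t ^ (2 * b) * t)) (t ^ 2)"
    using qbinomial_theorem[OF t2, of 0 "- (u / t ^ (2 * b) * t)"] by (simp add: inf0)
  then have "(\<lambda>a. u ^ b * t ^ b\<^sup>2 / ?Q b * qbinom_term (t ^ 2) 0 (- (u / t ^ (2 * b) * t)) a)
      sums (u ^ b * t ^ b\<^sup>2 / ?Q b * qpoch_inf (- (u / t ^ (2 * b) * t)) (t ^ 2))"
    by (rule sums_mult)
  moreover have "u ^ b * t ^ b\<^sup>2 / ?Q b * qbinom_term (t ^ 2) 0 (- (u / t ^ (2 * b) * t)) a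
      = u ^ (a + b) * hermite_term t a b" for a
  proof -
    have "(u / t ^ (2 * b)) ^ a = u ^ a / t ^ (2 * a * b)"
      by (simp add: power_divide flip: power_mult) (simp add: mult_ac)
    then show ?thesis
      unfolding qbinom_term_euler hermite_term_def by (simp add: power_add mult_ac)
  qed
  moreover have "u ^ b * t ^ b\<^sup>2 / ?Q b * qpoch_inf (- (u / t ^ (2 * b) * t)) (t ^ 2)
      = qbinom_term (t ^ 2) (u ^ 2) (- (u * t)) b * qpoch_inf (- (u * t)) (t ^ 2)"
  proof -
    have "(\<Prod>j<b. u ^ 2 - - (u * t) * (t ^ 2) ^ j) = (\<Prod>j<b. u * (u + t ^ (2 * j + 1)))"
      by (intro prod.cong refl, simp only: power_add power_mult) (simp add: algebra_simps power2_eq_square)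
    also have "\<dots> = u ^ b * (\<Prod>j<b. u + t ^ (2 * j + 1))"
      by (simp add: prod.distrib)
    finally have "qbinom_term (t ^ 2) (u ^ 2) (- (u * t)) b
        = u ^ b * (\<Prod>j<b. u + t ^ (2 * j + 1)) / ?Q b"
      by (simp add: qbinom_term_def)
    then show ?thesis
      using qpoch_inf_split_off[OF t, of b u] by (simp add: mult_ac)
  qed
  ultimately show ?thesis by simp
qed

section \<open>Absolute convergence and summation by antidiagonals\<close>

text \<open>The total exponent of \<open>t\<close> is a square, hence nonnegative, so that power has
  norm at most 1. The bound that is left separates \<open>a\<close> from \<open>b\<close>.\<close>

lemma norm_hermite_term_le:
  fixes t :: "'a::real_normed_field"
  assumes t: "t \<noteq> 0" "norm t < 1"
  shows "norm (hermite_term t a b)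
    \<le> norm (1 / qpoch (t ^ 2) (t ^ 2) a) * norm (1 / qpoch (t ^ 2) (t ^ 2) b)"
proof -
  have "real (2 * a * b) \<le> real (a\<^sup>2 + b\<^sup>2)"
    using sum_squares_bound[of "real a" "real b"] by simp
  then have "2 * a * b \<le> a\<^sup>2 + b\<^sup>2" by linarith
  then have "norm t ^ (a\<^sup>2 + b\<^sup>2) \<le> norm t ^ (2 * a * b)"
    using t by (intro power_decreasing) auto
  then have "norm (t ^ a\<^sup>2 * t ^ b\<^sup>2 / t ^ (2 * a * b)) \<le> 1"
    using t by (simp add: norm_mult norm_divide norm_power power_add field_simps)
  then have "norm (t ^ a\<^sup>2 * t ^ b\<^sup>2 / t ^ (2 * a * b))
      * norm (1 / (qpoch (t ^ 2) (t ^ 2) a * qpoch (t ^ 2) (t ^ 2) b))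
      \<le> 1 * norm (1 / (qpoch (t ^ 2) (t ^ 2) a * qpoch (t ^ 2) (t ^ 2) b))"
    by (rule mult_right_mono) simp
  then show ?thesis
    by (simp add: hermite_term_def norm_mult norm_divide)
qed

text \<open>The double family is dominated by the product family \<open>e b * e a\<close>. Here
  \<open>e\<close> is summable because its terms are the norms of q-binomial terms with
  \<open>z = u\<close> and \<open>a = 0\<close>.\<close>

lemma abs_summable_hermite:
  fixes t u :: "'a::{real_normed_field,banach}"
  assumes t: "t \<noteq> 0" "norm t < 1" and u: "norm u < 1"
  shows "(\<lambda>(b, a). norm (u ^ (a + b) * hermite_term t a b)) summable_on UNIV \<times> UNIV"
proof -
  let ?Q = "qpoch (t ^ 2) (t ^ 2)"
  define e where "e n = norm (u ^ n / ?Q n)" for n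
  have t2: "norm (t ^ 2) < 1" using t by (simp add: norm_power power_less_one_iff)
  have "summable e"
    using summable_norm_qbinom_term[OF t2 u, of 0]
    by (simp add: qbinom_term_def e_def[abs_def])
  then have e: "e summable_on UNIV"
    by (intro norm_summable_imp_summable_on) (simp add: e_def[abs_def])
  have "(\<lambda>p. norm (case p of (b, a) \<Rightarrow> e b * e a)) summable_on UNIV \<times> UNIV"
    unfolding Infinite_Sum.abs_summable_on_Sigma_iff
  proof (intro conjI ballI)
    have en: "\<bar>e b * e a\<bar> = e b * e a" for a b by (simp add: e_def)
    show "(\<lambda>a. norm (case (b, a) of (b, a) \<Rightarrow> e b * e a)) summable_on UNIV" for b
      using summable_on_cmult_right[OF e, of "e b"] by (simp add: en)
    have "0 \<le> e b * infsum e UNIV" for b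
      by (intro mult_nonneg_nonneg infsum_nonneg) (simp_all add: e_def)
    then show "(\<lambda>b. norm (\<Sum>\<^sub>\<infinity>a. norm (case (b, a) of (b, a) \<Rightarrow> e b * e a))) summable_on UNIV"
      using summable_on_cmult_left[OF e, of "infsum e UNIV"] by (simp add: en infsum_cmult_right')
  qed
  then show ?thesis
  proof (rule summable_on_comparison_test)
    fix p :: "nat \<times> nat"
    obtain b a where p: "p = (b, a)" by (cases p)
    have "norm (u ^ (a + b) * hermite_term t a b)
        \<le> norm (u ^ (a + b)) * (norm (1 / ?Q a) * norm (1 / ?Q b))"
      unfolding norm_mult by (intro mult_left_mono norm_hermite_term_le t) simp
    also have "\<dots> = norm (e b * e a)"
      by (simp add: e_def norm_mult norm_divide power_add mult_ac)
    finally show "(case p of (b, a) \<Rightarrow> norm (u ^ (a + b) * hermite_term t a b))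
        \<le> norm (case p of (b, a) \<Rightarrow> e b * e a)"
      by (simp add: p)
  qed (auto simp: case_prod_unfold)
qed

definition hermite_coeff :: "'a::field \<Rightarrow> nat \<Rightarrow> 'a" where
  "hermite_coeff t n = (\<Sum>a\<le>n. hermite_term t a (n - a))"

text \<open>Absolute summability permits summing one family in two ways. By rows, Euler's series and
  then the q-binomial theorem give the quotient of products; by antidiagonals
  \<open>a + b = n\<close> the coefficients appear.\<close>

theorem hermite_coeff_generating_function:
  fixes t u :: "'a::{real_normed_field,banach}"
  assumes t: "t \<noteq> 0" "norm t < 1" and u: "norm u < 1"
  shows "(\<lambda>n. u ^ n * hermite_coeff t n)
    sums (qpoch_inf (- (u * t)) (t ^ 2) ^ 2 / qpoch_inf (u ^ 2) (t ^ 2))"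
proof -
  let ?f = "\<lambda>(b, a). u ^ (a + b) * hermite_term t a b"
  let ?P = "qpoch_inf (- (u * t)) (t ^ 2)"
  have t2: "norm (t ^ 2) < 1" using t by (simp add: norm_power power_less_one_iff)
  have u2: "norm (u ^ 2) < 1" using u by (simp add: norm_power power_less_one_iff)
  have abs: "(\<lambda>p. norm (?f p)) summable_on UNIV \<times> UNIV"
    using abs_summable_hermite[OF t u] by (simp add: case_prod_unfold)
  then obtain s where s: "(?f has_sum s) (UNIV \<times> UNIV)"
    using Infinite_Sum.abs_summable_summable summable_on_def by blast
  have row: "((\<lambda>a. ?f (b, a)) has_sum qbinom_term (t ^ 2) (u ^ 2) (- (u * t)) b * ?P) UNIV" for b
  proof -
    have "(\<lambda>a. norm (?f (b, a))) summable_on UNIV"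
      using abs unfolding Infinite_Sum.abs_summable_on_Sigma_iff by blast
    then have "summable (\<lambda>a. norm (?f (b, a)))"
      using summable_on_imp_summable by blast
    then show ?thesis
      using hermite_term_sums_left[OF t, of u b]
      by (intro norm_summable_imp_has_sum) auto
  qed
  have "((\<lambda>b. qbinom_term (t ^ 2) (u ^ 2) (- (u * t)) b * ?P) has_sum s) UNIV"
    using has_sum_SigmaD[OF s row] .
  then have "(\<lambda>b. qbinom_term (t ^ 2) (u ^ 2) (- (u * t)) b * ?P) sums s"
    by (rule has_sum_imp_sums)
  moreover have "(\<lambda>b. qbinom_term (t ^ 2) (u ^ 2) (- (u * t)) b * ?P)
      sums (?P / qpoch_inf (u ^ 2) (t ^ 2) * ?P)"
    by (intro sums_mult2 qbinomial_theorem t2 u2)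
  ultimately have s_eq: "s = ?P ^ 2 / qpoch_inf (u ^ 2) (t ^ 2)"
    by (subst sums_unique2) (simp_all add: power2_eq_square)
  \<comment> \<open>Antidiagonal coordinates: the pair \<open>(b, a)\<close> corresponds to
    \<open>(a + b, a)\<close>.\<close>
  have bij: "bij_betw (\<lambda>(n, a). (n - a, a)) (Sigma UNIV (\<lambda>n. {..n})) (UNIV \<times> (UNIV :: nat set))"
    by (rule bij_betwI[where g = "\<lambda>(b, a). (a + b, a)"]) auto
  have "((\<lambda>(n, a). u ^ n * hermite_term t a (n - a)) has_sum s) (Sigma UNIV (\<lambda>n. {..n}))"
    using s unfolding has_sum_reindex_bij_betw[OF bij, of ?f s, symmetric]
    by (rule has_sum_cong[THEN iffD1, rotated]) auto
  then have "((\<lambda>n. \<Sum>a\<le>n. u ^ n * hermite_term t a (n - a)) has_sum s) UNIV"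
    by (rule has_sum_SigmaD) (auto intro!: has_sum_finiteI)
  then show ?thesis
    unfolding s_eq[symmetric] hermite_coeff_def sum_distrib_left by (rule has_sum_imp_sums)
qed

section \<open>Orders of orthogonal groups as q-Pochhammer symbols\<close>

text \<open>Each factor is \<open>q ^ (2 * i)\<close> times \<open>1 - (1 / q) ^ (2 * i)\<close>,
  and the exponents \<open>2 * i\<close> add up to \<open>m\<^sup>2 + m\<close>.\<close>

lemma prod_power_minus_one:
  fixes q :: "'a::field"
  assumes "q \<noteq> 0"
  shows "(\<Prod>i=1..m. q ^ (2 * i) - 1) = q ^ (m\<^sup>2 + m) * qpoch ((1 / q) ^ 2) ((1 / q) ^ 2) m"
proof (induction m)
  case (Suc m)
  have e: "(Suc m)\<^sup>2 + Suc m = (m\<^sup>2 + m) + 2 * Suc m"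
    by (simp add: power2_eq_square)
  have "(1 / q) ^ 2 * ((1 / q) ^ 2) ^ m = 1 / q ^ (2 * Suc m)"
    by (simp add: power_divide power_add power2_eq_square power_mult_distrib mult_2)
  then have "q ^ (2 * Suc m) * (1 - (1 / q) ^ 2 * ((1 / q) ^ 2) ^ m) = q ^ (2 * Suc m) - 1"
    using assms by (simp only: right_diff_distrib) simp
  then show ?case
    unfolding e qpoch_Suc power_add using Suc by (simp add: power_add mult_ac)
qed simp

text \<open>Reciprocals make the formulas uniform in \<open>a\<close>: at \<open>a = 0\<close> the
  numerators 2 and 0 over the denominator 2 reproduce the conventions for dimension 0.\<close>

lemma O_even_order:
  fixes q :: real
  assumes "q > 1"
  shows O_plus_order_even:
      "1 / O_plus_order (2 * a) q = (q ^ a + 1) / (2 * q ^ (2 * a\<^sup>2) * qpoch ((1 / q) ^ 2) ((1 / q) ^ 2) a)"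
    and O_minus_order_even:
      "1 / O_minus_order (2 * a) q = (q ^ a - 1) / (2 * q ^ (2 * a\<^sup>2) * qpoch ((1 / q) ^ 2) ((1 / q) ^ 2) a)"
proof -
  have "a \<le> a\<^sup>2" by (simp add: power2_eq_square)
  then have "q ^ (a\<^sup>2 - a) * q ^ (a\<^sup>2 + a) = q ^ (2 * a\<^sup>2)"
    by (simp add: mult_2 flip: power_add)
  then have *: "2 * q ^ (a\<^sup>2 - a) / d * (q ^ (a\<^sup>2 + a) * Q) = 2 * q ^ (2 * a\<^sup>2) * Q / d" for d Q
    by (simp flip: mult.assoc)
  have q0: "q \<noteq> 0" using assms by simp
  show "1 / O_plus_order (2 * a) q = (q ^ a + 1) / (2 * q ^ (2 * a\<^sup>2) * qpoch ((1 / q) ^ 2) ((1 / q) ^ 2) a)"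
    by (cases "a = 0") (simp_all add: O_plus_order_def Let_def prod_power_minus_one[OF q0] * del: One_nat_def times_divide_eq_left times_divide_eq_right)
  show "1 / O_minus_order (2 * a) q = (q ^ a - 1) / (2 * q ^ (2 * a\<^sup>2) * qpoch ((1 / q) ^ 2) ((1 / q) ^ 2) a)"
    by (cases "a = 0") (simp_all add: O_minus_order_def Let_def prod_power_minus_one[OF q0] * del: One_nat_def times_divide_eq_left times_divide_eq_right)
qed

lemma O_odd_order:
  fixes q :: real
  assumes "q > 1"
  shows O_plus_order_odd:
      "O_plus_order (2 * a + 1) q = 2 * q ^ (2 * a\<^sup>2 + a) * qpoch ((1 / q) ^ 2) ((1 / q) ^ 2) a"
    and O_minus_order_odd:
      "O_minus_order (2 * a + 1) q = 2 * q ^ (2 * a\<^sup>2 + a) * qpoch ((1 / q) ^ 2) ((1 / q) ^ 2) a"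
proof -
  have q0: "q \<noteq> 0" using assms by simp
  have "2 * a\<^sup>2 + a = a\<^sup>2 + (a\<^sup>2 + a)" by simp
  then have e: "q ^ (2 * a\<^sup>2 + a) = q ^ a\<^sup>2 * q ^ (a\<^sup>2 + a)" by (simp only: power_add)
  show "O_plus_order (2 * a + 1) q = 2 * q ^ (2 * a\<^sup>2 + a) * qpoch ((1 / q) ^ 2) ((1 / q) ^ 2) a"
    unfolding e by (simp add: O_plus_order_def Let_def prod_power_minus_one[OF q0] del: One_nat_def)
  show "O_minus_order (2 * a + 1) q = 2 * q ^ (2 * a\<^sup>2 + a) * qpoch ((1 / q) ^ 2) ((1 / q) ^ 2) a"
    unfolding e by (simp add: O_minus_order_def Let_def prod_power_minus_one[OF q0] del: One_nat_def)
qed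

text \<open>The exponent is rewritten by \<open>- (a - b)\<^sup>2 = (a + b)\<^sup>2 - 2 * a\<^sup>2
  - 2 * b\<^sup>2\<close>, which matches the weight \<open>q ^ n\<^sup>2\<close> and the powers of
  \<open>q\<close> in the orders.\<close>

lemma hermite_term_inverse:
  fixes q :: real
  assumes "q > 1"
  shows "hermite_term (1 / q) a b = q ^ (a + b)\<^sup>2
    / (q ^ (2 * a\<^sup>2) * q ^ (2 * b\<^sup>2) * (qpoch ((1 / q) ^ 2) ((1 / q) ^ 2) a * qpoch ((1 / q) ^ 2) ((1 / q) ^ 2) b))"
proof -
  have q0: "q \<noteq> 0" using assms by simp
  have e: "(a + b)\<^sup>2 = a\<^sup>2 + b\<^sup>2 + 2 * a * b" by (rule power2_sum)
  \<comment> \<open>To be read with \<open>A = q ^ a\<^sup>2\<close>,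
    \<open>B = q ^ b\<^sup>2\<close> and \<open>C = q ^ (2 * a * b)\<close>.\<close>
  have cancel: "1 / A * (1 / B) / (1 / C) = A * B * C / (A * A * (B * B))"
    if "A \<noteq> 0" "B \<noteq> 0" for A B C :: real
    using that by simp
  have "(1 / q) ^ a\<^sup>2 * (1 / q) ^ b\<^sup>2 / (1 / q) ^ (2 * a * b)
      = q ^ (a + b)\<^sup>2 / (q ^ (2 * a\<^sup>2) * q ^ (2 * b\<^sup>2))"
    unfolding e power_one_over power_add mult_2[of "_\<^sup>2"] using q0 by (intro cancel) simp_all
  then show ?thesis by (simp add: hermite_term_def)
qed

text \<open>With \<open>x = q ^ a\<close> and \<open>y = q ^ b\<close>, the cross terms of
  \<open>(x + 1) * (y + 1)\<close> and \<open>(x - 1) * (y - 1)\<close> cancel. Only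
  \<open>q ^ (a + b) + 1\<close> survives, which is why the final series involves \<open>F\<close>
  at both \<open>u q\<close> and \<open>u\<close>.\<close>

lemma O_even_pair:
  fixes q :: real
  assumes q: "q > 1"
  shows "q ^ (a + b)\<^sup>2 * (1 / (O_plus_order (2 * a) q * O_plus_order (2 * b) q)
      + 1 / (O_minus_order (2 * a) q * O_minus_order (2 * b) q))
    = (q ^ (a + b) + 1) / 2 * hermite_term (1 / q) a b"
proof -
  have split: "1 / (x * y) = (1 / x) * (1 / y)" for x y :: real by simp
  have pair: "N * ((x + 1) / (2 * A * C) * ((y + 1) / (2 * B * D)) + (x - 1) / (2 * A * C) * ((y - 1) / (2 * B * D)))
      = (x * y + 1) / 2 * (N / (A * B * (C * D)))" for N x y A B C D :: real
  proof -
    have "(x + 1) / (2 * A * C) * ((y + 1) / (2 * B * D)) + (x - 1) / (2 * A * C) * ((y - 1) / (2 * B * D))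
        = ((x + 1) * (y + 1) + (x - 1) * (y - 1)) / (4 * (A * B * (C * D)))"
      unfolding times_divide_times_eq add_divide_distrib[symmetric] by (simp add: mult_ac)
    moreover have "(x + 1) * (y + 1) + (x - 1) * (y - 1) = 2 * (x * y + 1)"
      by (simp add: algebra_simps)
    moreover have "N * (2 * z / (4 * K)) = z / 2 * (N / K)" for z K :: real by simp
    ultimately show ?thesis by (simp only:)
  qed
  show ?thesis
    unfolding split[of "O_plus_order _ q"] split[of "O_minus_order _ q"]
      O_plus_order_even[OF q] O_minus_order_even[OF q] hermite_term_inverse[OF q] power_add[of q a b]
    by (rule pair)
qed

text \<open>In odd dimension both types have the same order, so the two fractions coincide. Of the
  surplus exponent \<open>(a + b) + Suc (a + b)\<close>, the first part cancels against the factors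
  \<open>q ^ a\<close> and \<open>q ^ b\<close> of the orders.\<close>

lemma O_odd_pair:
  fixes q :: real
  assumes q: "q > 1"
  shows "q ^ (Suc (a + b))\<^sup>2 * (1 / (O_plus_order (2 * a + 1) q * O_plus_order (2 * b + 1) q)
      + 1 / (O_minus_order (2 * a + 1) q * O_minus_order (2 * b + 1) q))
    = q ^ Suc (a + b) / 2 * hermite_term (1 / q) a b"
proof -
  have pair: "N * (r * s) * M * (1 / (2 * (A * r) * C * (2 * (B * s) * D)) + 1 / (2 * (A * r) * C * (2 * (B * s) * D)))
      = M / 2 * (N / (A * B * (C * D)))" if "r \<noteq> 0" "s \<noteq> 0" for N M r s A B C D :: real
    using that by (simp add: mult_ac)
  have "(Suc (a + b))\<^sup>2 = (a + b)\<^sup>2 + (a + b) + Suc (a + b)"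
    by (simp add: power2_eq_square)
  then have e: "q ^ (Suc (a + b))\<^sup>2 = q ^ (a + b)\<^sup>2 * (q ^ a * q ^ b) * q ^ Suc (a + b)"
    by (simp only: power_add)
  show ?thesis
    unfolding O_plus_order_odd[OF q] O_minus_order_odd[OF q] hermite_term_inverse[OF q] e
      power_add[of q "2 * _"]
    using q by (intro pair) simp_all
qed

lemma sum_even_odd:
  fixes f :: "nat \<Rightarrow> 'a::comm_monoid_add"
  shows "(\<Sum>r=0..2*n. f r) = (\<Sum>a\<le>n. f (2 * a)) + (\<Sum>a<n. f (2 * a + 1))"
  by (induction n) (simp_all add: add_ac)

text \<open>Splitting by the parity of \<open>r\<close>, even indices \<open>2 * a\<close> and
  \<open>2 * b\<close> have \<open>a + b = n\<close>, while odd indices \<open>2 * a + 1\<close> and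
  \<open>2 * b + 1\<close> have \<open>a + b = n - 1\<close>. Hence two consecutive coefficients
  occur.\<close>

lemma O_order_sum:
  fixes q :: real
  assumes q: "q > 1"
  shows "q ^ n\<^sup>2 * ((\<Sum>r=0..2*n. 1 / (O_plus_order r q * O_plus_order (2*n - r) q))
      + (\<Sum>r=1..2*n-1. 1 / (O_minus_order r q * O_minus_order (2*n - r) q)))
    = (q ^ n + 1) / 2 * hermite_coeff (1 / q) n
      + (if n = 0 then 0 else q ^ n / 2 * hermite_coeff (1 / q) (n - 1))"
proof -
  define f where "f r = 1 / (O_plus_order r q * O_plus_order (2*n - r) q)
    + 1 / (O_minus_order r q * O_minus_order (2*n - r) q)" for r
  have m0: "O_minus_order 0 q = 0" by (simp add: O_minus_order_def)
  have "(\<Sum>r=1..2*n-1. 1 / (O_minus_order r q * O_minus_order (2*n - r) q))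
      = (\<Sum>r=0..2*n. 1 / (O_minus_order r q * O_minus_order (2*n - r) q))"
  \<comment> \<open>The added end terms contain the order 0 of dimension 0 and vanish as quotients
    by 0. This includes \<open>n = 0\<close>, where the shorter range is empty.\<close>
  proof (rule sum.mono_neutral_left)
    show "\<forall>r\<in>{0..2*n} - {1..2*n-1}. 1 / (O_minus_order r q * O_minus_order (2*n - r) q) = 0"
    proof
      fix r assume "r \<in> {0..2*n} - {1..2*n-1}"
      then have "r = 0 \<or> r = 2 * n" by auto
      then show "1 / (O_minus_order r q * O_minus_order (2*n - r) q) = 0"
        using m0 by auto
    qed
  qed auto
  then have "(\<Sum>r=0..2*n. 1 / (O_plus_order r q * O_plus_order (2*n - r) q))
      + (\<Sum>r=1..2*n-1. 1 / (O_minus_order r q * O_minus_order (2*n - r) q)) = (\<Sum>r=0..2*n. f r)"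
    by (simp add: f_def sum.distrib)
  also have "\<dots> = (\<Sum>a\<le>n. f (2 * a)) + (\<Sum>a<n. f (2 * a + 1))"
    by (rule sum_even_odd)
  finally have *: "(\<Sum>r=0..2*n. 1 / (O_plus_order r q * O_plus_order (2*n - r) q))
      + (\<Sum>r=1..2*n-1. 1 / (O_minus_order r q * O_minus_order (2*n - r) q))
      = (\<Sum>a\<le>n. f (2 * a)) + (\<Sum>a<n. f (2 * a + 1))" .
  have even: "q ^ n\<^sup>2 * f (2 * a) = (q ^ n + 1) / 2 * hermite_term (1 / q) a (n - a)" if "a \<le> n" for a
  proof -
    have "2 * n - 2 * a = 2 * (n - a)" by simp
    then show ?thesis
      using O_even_pair[OF q, of a "n - a"] that by (simp add: f_def)
  qed
  have odd: "q ^ n\<^sup>2 * f (2 * a + 1) = q ^ n / 2 * hermite_term (1 / q) a (n - 1 - a)" if "a < n" for a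
  proof -
    have "2 * n - (2 * a + 1) = 2 * (n - 1 - a) + 1" "Suc (a + (n - 1 - a)) = n"
      using that by auto
    then show ?thesis
      using O_odd_pair[OF q, of a "n - 1 - a"] by (simp only: f_def)
  qed
  have "(\<Sum>a<n. hermite_term (1 / q) a (n - 1 - a)) = (if n = 0 then 0 else hermite_coeff (1 / q) (n - 1))"
    by (cases n) (simp_all add: hermite_coeff_def lessThan_Suc_atMost)
  moreover have "(\<Sum>a<n. q ^ n\<^sup>2 * f (2 * a + 1)) = q ^ n / 2 * (\<Sum>a<n. hermite_term (1 / q) a (n - 1 - a))"
    unfolding sum_distrib_left using odd by (intro sum.cong) auto
  ultimately have "(\<Sum>a<n. q ^ n\<^sup>2 * f (2 * a + 1))
      = (if n = 0 then 0 else q ^ n / 2 * hermite_coeff (1 / q) (n - 1))"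
    by simp
  moreover have "(\<Sum>a\<le>n. q ^ n\<^sup>2 * f (2 * a)) = (q ^ n + 1) / 2 * hermite_coeff (1 / q) n"
    by (simp add: even hermite_coeff_def sum_distrib_left)
  ultimately show ?thesis
    unfolding * by (simp add: distrib_left sum_distrib_left)
qed

section \<open>Passage to complex numbers and assembly of the series\<close>

lemma of_real_hermite_coeff:
  "of_real (hermite_coeff t n) = (hermite_coeff (of_real t) n :: 'a::real_field)"
  by (simp add: hermite_coeff_def hermite_term_def of_real_qpoch)

theorem theorem2p11:
  fixes q :: real and u :: complex
  assumes "q > 1" and "norm u < 1 / q"
  shows "convergent_prod (\<lambda>i. (1 + u / of_real q ^ (2 * i)) ^ 2)
    \<and> convergent_prod (\<lambda>i. (1 + u / of_real q ^ (2 * i + 1)) ^ 2)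
    \<and> convergent_prod (\<lambda>i. 1 - u ^ 2 / of_real q ^ (2 * i))
    \<and> (\<lambda>n. u ^ n * of_real q ^ (n ^ 2) *
         of_real ((\<Sum>r=0..2*n. 1 / (O_plus_order r q * O_plus_order (2*n - r) q))
                + (\<Sum>r=1..2*n-1. 1 / (O_minus_order r q * O_minus_order (2*n - r) q))))
      sums
      (1 / (2 * (1 - u * of_real q)) *
         ((\<Prod>i. (1 + u / of_real q ^ (2 * i)) ^ 2) / (\<Prod>i. 1 - u ^ 2 / of_real q ^ (2 * i)))
       + 1 / 2 *
         ((\<Prod>i. (1 + u / of_real q ^ (2 * i + 1)) ^ 2) / (\<Prod>i. 1 - u ^ 2 / of_real q ^ (2 * i))))"
proof -
  define t :: complex where "t = 1 / of_real q"
  define h where "h = hermite_coeff t"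
  define F where "F v = qpoch_inf (- (v * t)) (t ^ 2) ^ 2 / qpoch_inf (v ^ 2) (t ^ 2)" for v
  have q: "q > 0" "of_real q \<noteq> (0::complex)" using assms by auto
  have t: "t \<noteq> 0" "norm t < 1"
    using assms q by (auto simp: t_def norm_divide)
  have t2: "norm (t ^ 2) < 1" using t by (simp add: norm_power power_less_one_iff)
  have tq: "of_real q * t = 1" using q by (simp add: t_def)
  have uq: "norm (u * of_real q) < 1"
    using assms q by (simp add: norm_mult field_simps)
  have "1 / q < 1" using assms by simp
  then have u: "norm u < 1" using assms by linarith
  have u2: "norm (u ^ 2) < 1" using u by (simp add: norm_power power_less_one_iff)
  have even: "1 + u / of_real q ^ (2 * i) = 1 - - u * (t ^ 2) ^ i" for i
    by (simp add: t_def power_divide power_mult)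
  have odd: "1 + u / of_real q ^ (2 * i + 1) = 1 - - (u * t) * (t ^ 2) ^ i" for i
    by (simp add: t_def power_divide power_mult)
  have den: "1 - u ^ 2 / of_real q ^ (2 * i) = 1 - u ^ 2 * (t ^ 2) ^ i" for i
    by (simp add: t_def power_divide power_mult)
  have prod_even: "(\<Prod>i. (1 + u / of_real q ^ (2 * i)) ^ 2) = qpoch_inf (- u) (t ^ 2) ^ 2"
    unfolding even qpoch_inf_def by (rule prodinf_power[OF convergent_prod_qpoch_inf[OF t2]])
  have prod_odd: "(\<Prod>i. (1 + u / of_real q ^ (2 * i + 1)) ^ 2) = qpoch_inf (- (u * t)) (t ^ 2) ^ 2"
    unfolding odd qpoch_inf_def by (rule prodinf_power[OF convergent_prod_qpoch_inf[OF t2]])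
  have prod_den: "(\<Prod>i. 1 - u ^ 2 / of_real q ^ (2 * i)) = qpoch_inf (u ^ 2) (t ^ 2)"
    unfolding den qpoch_inf_def ..
  have F_sums: "(\<lambda>n. v ^ n * h n) sums F v" if "norm v < 1" for v
    unfolding F_def h_def by (rule hermite_coeff_generating_function[OF t that])
  \<comment> \<open>The contribution of odd \<open>r\<close>: the generating function at
    \<open>u q\<close>, delayed by one index and so multiplied by \<open>u q\<close>.\<close>
  define g where "g n = (if n = 0 then 0 else (u * of_real q) ^ n * h (n - 1))" for n
  have "(\<lambda>n. g (Suc n)) sums (u * of_real q * F (u * of_real q))"
    using sums_mult[OF F_sums[OF uq], of "u * of_real q"] by (simp add: g_def mult.assoc)
  then have "g sums (u * of_real q * F (u * of_real q))"
    by (rule sums_Suc_imp[rotated]) (simp add: g_def)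
  then have sums: "(\<lambda>n. 1 / 2 * ((u * of_real q) ^ n * h n + u ^ n * h n + g n))
      sums (1 / 2 * (F (u * of_real q) + F u + u * of_real q * F (u * of_real q)))"
    by (intro sums_mult sums_add F_sums uq u)
  have summand: "u ^ n * of_real q ^ (n ^ 2) *
         of_real ((\<Sum>r=0..2*n. 1 / (O_plus_order r q * O_plus_order (2*n - r) q))
                + (\<Sum>r=1..2*n-1. 1 / (O_minus_order r q * O_minus_order (2*n - r) q)))
      = 1 / 2 * ((u * of_real q) ^ n * h n + u ^ n * h n + g n)" for n
  proof -
    have h: "of_real (hermite_coeff (1 / q) m) = h m" for m
      by (simp add: of_real_hermite_coeff h_def t_def)
    show ?thesis
      unfolding mult.assoc of_real_power[symmetric] of_real_mult[symmetric] O_order_sum[OF assms(1)]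
      by (simp add: h g_def algebra_simps power_mult_distrib add_divide_distrib)
  qed
  \<comment> \<open>The denominator of \<open>F\<close> at \<open>u q\<close> begins with the factor
    \<open>1 - (u q)^2\<close>; removing it leaves the denominator at \<open>u\<close>. The
    prefactor \<open>1 + u q\<close>, which joins the even and odd contributions, cancels half of
    that factor and leaves \<open>1 / (1 - u q)\<close>.\<close>
  have total: "1 / 2 * (F (u * of_real q) + F u + u * of_real q * F (u * of_real q))
      = 1 / (2 * (1 - u * of_real q)) * (qpoch_inf (- u) (t ^ 2) ^ 2 / qpoch_inf (u ^ 2) (t ^ 2))
        + 1 / 2 * (qpoch_inf (- (u * t)) (t ^ 2) ^ 2 / qpoch_inf (u ^ 2) (t ^ 2))"
  proof -
    have nz: "1 - v \<noteq> 0" if "norm v < 1" for v :: complex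
      using that by auto
    have nz1: "1 - u * of_real q \<noteq> 0" "1 + u * of_real q \<noteq> 0"
      using nz[of "u * of_real q"] nz[of "- (u * of_real q)"] uq by simp_all
    have sq: "(u * of_real q) ^ 2 * t ^ 2 = u ^ 2"
      using tq by (metis mult.assoc mult.right_neutral power_mult_distrib)
    have factor: "1 - (u * of_real q) ^ 2 = (1 - u * of_real q) * (1 + u * of_real q)"
      by (simp add: algebra_simps power2_eq_square)
    have "qpoch_inf ((u * of_real q) ^ 2) (t ^ 2)
        = (1 - u * of_real q) * (1 + u * of_real q) * qpoch_inf (u ^ 2) (t ^ 2)"
      using qpoch_inf_rec[OF t2, of "(u * of_real q) ^ 2"] by (simp only: sq factor)
    moreover have "- (u * of_real q * t) = - u"
      using tq by (simp add: mult.assoc)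
    ultimately have "F (u * of_real q) = qpoch_inf (- u) (t ^ 2) ^ 2
        / ((1 - u * of_real q) * (1 + u * of_real q) * qpoch_inf (u ^ 2) (t ^ 2))"
      by (simp only: F_def)
    then have "(1 + u * of_real q) * F (u * of_real q)
        = 1 / (1 - u * of_real q) * (qpoch_inf (- u) (t ^ 2) ^ 2 / qpoch_inf (u ^ 2) (t ^ 2))"
      using nz1 by simp
    moreover have "1 / 2 * (F (u * of_real q) + F u + u * of_real q * F (u * of_real q))
        = 1 / 2 * ((1 + u * of_real q) * F (u * of_real q)) + 1 / 2 * F u"
      by (simp add: algebra_simps)
    moreover have "1 / 2 * (1 / d * X) = 1 / (2 * d) * X" for d X :: complex
      by simp
    ultimately show ?thesis by (simp only: F_def[of u])
  qed
  show ?thesis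
    unfolding prod_even prod_odd prod_den summand total[symmetric]
    unfolding even odd den
    by (intro conjI convergent_prod_power convergent_prod_qpoch_inf t2 sums)
qed

end
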